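(* Let $(\mathcal{G},p)$ be a local-relative-measurement-based network in $\mathbb{R}^3$ with anchor nodes $\mathcal{V}_a$ and free nodes $\mathcal{V}_f$, and assume: no two nodes are collocated; each anchor node has at least two neighboring anchor nodes; each free node has at least four neighboring nodes; and, when the measurements are local relative bearings or angles, each free node and its neighbors are non-colinear. Suppose $(\mathcal{G},p)$ has at least three non-colinear anchor nodes ($n_a\ge3$) and is infinitesimally angle-displacement rigid in $\mathbb{R}^3$. Then, given arbitrary initial estimates $\hat p_i(0)$, $i\in\mathcal{V}_f$, under the distributed localization protocol $$\dot{\hat p}_f=-D_{ff}\hat p_f-D_{fa}p_a,$$ $\hat p_i(t)$ converges to $p_i$ globally and exponentially fast for all free nodes $i\in\mathcal{V}_f$.
   Context: $\mathcal{G}=(\mathcal{V},\mathcal{E})$ is an undirected graph with $\mathcal{V}=\{1,\dots,n\}$, and $p=(p_1^T,\dots,p_n^T)^T\in\mathbb{R}^{3n}$. Anchor nodes $\mathcal{V}_a=\{1,\dots,n_a\}$ have known positions $p_a=(p_1^T,\dots,p_{n_a}^T)^T$; free nodes $\mathcal{V}_f=\{n_a+1,\dots,n\}$, $n_f=n-n_a$, have unknown positions $p_f=(p_{n_a+1}^T,\dots,p_n^T)^T$; $\hat p_f(t)\in\mathbb{R}^{3n_f}$ is the stacked vector of estimates $\hat p_i(t)$, $i\in\mathcal{V}_f$. For $x\in\mathbb{R}^{3n}$ write $e_{ij}(x)=x_j-x_i$. Displacement constraints. $\mathcal{X}_{\mathcal{G}}$ is the set of 5-tuples for which displacement constraints are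 constructed from the local relative measurements (all of one type: local relative position, distance, local relative bearing, angle, or ratio-of-distance). It consists of 5-tuples $(i,j,k,h,l)$ with $(i,j),(i,k),(i,h),(i,l)\in\mathcal{E}$, $j<k<h<l$ (all such tuples for local relative position measurements; in general a subset). Each tuple comes with a fixed nonzero vector $(\mu_{ij},\mu_{ik},\mu_{ih},\mu_{il})\in\mathbb{R}^4$ (obtained from the measurements) with $\mu_{ij}e_{ij}(p)+\mu_{ik}e_{ik}(p)+\mu_{ih}e_{ih}(p)+\mu_{il}e_{il}(p)=\mathbf{0}$. Angle constraints (only among anchors). $\Upsilon_{\mathcal{G}}$ is the set of triples $(i,j,k)$ of anchor nodes with $i<j<k$ and $(i,j),(i,k),(j,k)\in\mathcal{E}$. With $a=e_{ik}(p)^Te_{ij}(p)$, $b=e_{ki}(p)^Te_{kj}(p)$, put $(w_{ik},w_{ki})=(1/a,-1/b)$ if $a,b\neq0$; $(1,0)$ if $a=0,b\ne0$; $(0,1)$ if $a\neq0,b=0$; $(1,1)$ if $a=b=0$; so $w_{ik}e_{ik}(p)^Te_{ij}(p)+w_{ki}e_{ki}(p)^Te_{kj}(p)=0$. With all coefficients held fixed, the angle-displacement function $f(x)$ stacks the scalars $w_{ik}e_{ik}(x)^Te_{ij}(x)+w_{ki}e_{ki}(x)^Te_{kj}(x)$ over $\Upsilon_{\mathcal{G}}$ and the vectors $\mu_{ij}e_{ij}(x)+\mu_{ik}e_{ik}(x)+\mu_{ih}e_{ih}(x)+\mu_{il}e_{il}(x)$ over $\mathcal{X}_{\mathcal{G}}$.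 The rigidity matrix is $R(p)=\partial f(x)/\partial x|_{x=p}$, and the angle-displacement information matrix is $D=R(p)^TR(p)=\begin{pmatrix}D_{aa}&D_{af}\\ D_{fa}&D_{ff}\end{pmatrix}$, partitioned according to anchors ($3n_a$) and free nodes ($3n_f$). The network is infinitesimally angle-displacement rigid if all $\delta p$ with $R(p)\delta p=0$ are trivial (correspond to a translation, a rotation and a scaling of the entire network), i.e. $\dim\mathrm{Null}(R(p))=7$; equivalently $\mathrm{Null}(R(p))=\mathrm{Span}\{\mathbf{1}_n\otimes I_3,\ p,\ (I_n\otimes A)p: A+A^T=\mathbf{0},A\in\mathbb{R}^{3\times3}\}$. *)

theory Defs
  imports "HOL-Analysis.Analysis"
begin

text \<open>
  Anchors are the elements of a finite linearly ordered type \<open>'a\<close> and free nodes those of a finite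
  linearly ordered type \<open>'f\<close>, so the vertex set is \<open>'a + 'f\<close>, with \<open>n\<^sub>a = CARD('a)\<close> and
  \<open>n\<^sub>f = CARD('f)\<close>. The numbering \<open>1, \<dots>, n\<close> of the nodes, anchors first, is rendered by the order
  \<open>node_less\<close>. A stacked vector in \<open>\<real>\<^sup>3\<^sup>n\<close> has its entries indexed by (node, coordinate).
\<close>

type_synonym ('a, 'f) config = "real ^ (('a + 'f) \<times> 3)"

type_synonym ('a, 'f) graph = "(('a + 'f) \<times> ('a + 'f)) set"

type_synonym 'v quintuple = "'v \<times> 'v \<times> 'v \<times> 'v \<times> 'v"

fun node_less :: "'a::linorder + 'f::linorder \<Rightarrow> 'a + 'f \<Rightarrow> bool" where
  "node_less (Inl i) (Inl j) \<longleftrightarrow> i < j"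
| "node_less (Inl i) (Inr j) \<longleftrightarrow> True"
| "node_less (Inr i) (Inl j) \<longleftrightarrow> False"
| "node_less (Inr i) (Inr j) \<longleftrightarrow> i < j"

definition pos :: "real ^ ('v::finite \<times> 3) \<Rightarrow> 'v \<Rightarrow> real ^ 3" where
  "pos x i = (\<chi> c. x $ (i, c))"

definition stack :: "('v::finite \<Rightarrow> real ^ 3) \<Rightarrow> real ^ ('v \<times> 3)" where
  "stack q = (\<chi> u. q (fst u) $ snd u)"

definition edge_vec :: "real ^ ('v::finite \<times> 3) \<Rightarrow> 'v \<Rightarrow> 'v \<Rightarrow> real ^ 3" where
  "edge_vec x i j = pos x j - pos x i"

definition neighbors :: "('v \<times> 'v) set \<Rightarrow> 'v \<Rightarrow> 'v set" where
  "neighbors E i = {j. (i, j) \<in> E}"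

definition undirected_graph :: "('v \<times> 'v) set \<Rightarrow> bool" where
  "undirected_graph E \<longleftrightarrow> sym E \<and> irrefl E"

datatype measurement_type =
  Relative_Position | Distance | Relative_Bearing | Angle | Ratio_Of_Distance


subsection \<open>Displacement and angle constraints\<close>

definition displacement_tuples ::
    "('a::linorder, 'f::linorder) graph \<Rightarrow> ('a + 'f) quintuple set" where
  "displacement_tuples E =
     {(i, j, k, h, l). (i, j) \<in> E \<and> (i, k) \<in> E \<and> (i, h) \<in> E \<and> (i, l) \<in> E \<and>
        node_less j k \<and> node_less k h \<and> node_less h l}"

fun displacement_fun ::
    "('v quintuple \<Rightarrow> real ^ 4) \<Rightarrow> real ^ ('v::finite \<times> 3) \<Rightarrow> 'v quintuple \<Rightarrow> real ^ 3" where
  "displacement_fun \<mu> x (i, j, k, h, l) =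
     (\<mu> (i, j, k, h, l) $ 1) *\<^sub>R edge_vec x i j + (\<mu> (i, j, k, h, l) $ 2) *\<^sub>R edge_vec x i k +
     (\<mu> (i, j, k, h, l) $ 3) *\<^sub>R edge_vec x i h + (\<mu> (i, j, k, h, l) $ 4) *\<^sub>R edge_vec x i l"

text \<open>
  The coefficients are obtained from measurements of a single type; which tuples carry a constraint
  depends on that type and on the measurements, except for relative positions, where all of them do.
\<close>

definition displacement_constraints ::
    "measurement_type \<Rightarrow> ('a::{finite,linorder}, 'f::{finite,linorder}) graph \<Rightarrow>
     ('a + 'f) quintuple set \<Rightarrow> (('a + 'f) quintuple \<Rightarrow> real ^ 4) \<Rightarrow> ('a, 'f) config \<Rightarrow> bool" where
  "displacement_constraints M E X \<mu> p \<longleftrightarrow>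
     X \<subseteq> displacement_tuples E \<and>
     (M = Relative_Position \<longrightarrow> X = displacement_tuples E) \<and>
     (\<forall>\<tau>\<in>X. \<mu> \<tau> \<noteq> 0 \<and> displacement_fun \<mu> p \<tau> = 0)"

definition angle_triples :: "('a::linorder, 'f) graph \<Rightarrow> ('a \<times> 'a \<times> 'a) set" where
  "angle_triples E =
     {(i, j, k). i < j \<and> j < k \<and>
        (Inl i, Inl j) \<in> E \<and> (Inl i, Inl k) \<in> E \<and> (Inl j, Inl k) \<in> E}"

definition angle_weights :: "real \<Rightarrow> real \<Rightarrow> real \<times> real" where
  "angle_weights a b =
     (if a \<noteq> 0 \<and> b \<noteq> 0 then (1 / a, - (1 / b))
      else if a = 0 \<and> b \<noteq> 0 then (1, 0)
      else if a \<noteq> 0 \<and> b = 0 then (0, 1)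
      else (1, 1))"

text \<open>The weights are computed at \<open>p\<close> and stay fixed as the configuration \<open>x\<close> varies.\<close>

fun angle_fun :: "('a::finite, 'f::finite) config \<Rightarrow> ('a, 'f) config \<Rightarrow> 'a \<times> 'a \<times> 'a \<Rightarrow> real" where
  "angle_fun p x (i, j, k) =
     (let e = (\<lambda>y u v. edge_vec y (Inl u) (Inl v));
          (w_ik, w_ki) = angle_weights (e p i k \<bullet> e p i j) (e p k i \<bullet> e p k j)
      in w_ik * (e x i k \<bullet> e x i j) + w_ki * (e x k i \<bullet> e x k j))"


subsection \<open>Angle-displacement function, rigidity matrix, information matrix\<close>

text \<open>
  The rows are indexed by all triples of anchors and all (5-tuple, coordinate) pairs. Rows outside
  \<open>angle_triples E\<close> and \<open>X\<close> are identically zero, which changes neither the null space of \<open>R\<close> nor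
  \<open>R\<^sup>T R\<close>.
\<close>

type_synonym ('a, 'f) row = "('a \<times> 'a \<times> 'a) + (('a + 'f) quintuple \<times> 3)"

definition angle_displacement_fun ::
    "('a::{finite,linorder}, 'f::{finite,linorder}) graph \<Rightarrow> ('a + 'f) quintuple set \<Rightarrow>
     (('a + 'f) quintuple \<Rightarrow> real ^ 4) \<Rightarrow> ('a, 'f) config \<Rightarrow> ('a, 'f) config \<Rightarrow>
     real ^ ('a, 'f) row" where
  "angle_displacement_fun E X \<mu> p x =
     (\<chi> r. case r of
        Inl t \<Rightarrow> if t \<in> angle_triples E then angle_fun p x t else 0
      | Inr (\<tau>, c) \<Rightarrow> if \<tau> \<in> X then displacement_fun \<mu> x \<tau> $ c else 0)"

definition rigidity_matrix ::
    "('a::{finite,linorder}, 'f::{finite,linorder}) graph \<Rightarrow> ('a + 'f) quintuple set \<Rightarrow>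
     (('a + 'f) quintuple \<Rightarrow> real ^ 4) \<Rightarrow> ('a, 'f) config \<Rightarrow>
     real ^ (('a + 'f) \<times> 3) ^ ('a, 'f) row" where
  "rigidity_matrix E X \<mu> p = jacobian (angle_displacement_fun E X \<mu> p) (at p)"

definition information_matrix ::
    "('a::{finite,linorder}, 'f::{finite,linorder}) graph \<Rightarrow> ('a + 'f) quintuple set \<Rightarrow>
     (('a + 'f) quintuple \<Rightarrow> real ^ 4) \<Rightarrow> ('a, 'f) config \<Rightarrow>
     real ^ (('a + 'f) \<times> 3) ^ (('a + 'f) \<times> 3)" where
  "information_matrix E X \<mu> p =
     transpose (rigidity_matrix E X \<mu> p) ** rigidity_matrix E X \<mu> p"

definition anchor_part :: "('a::finite, 'f::finite) config \<Rightarrow> real ^ ('a \<times> 3)" where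
  "anchor_part x = stack (\<lambda>i. pos x (Inl i))"

definition free_part :: "('a::finite, 'f::finite) config \<Rightarrow> real ^ ('f \<times> 3)" where
  "free_part x = stack (\<lambda>i. pos x (Inr i))"

definition block_ff ::
    "real ^ (('a::finite + 'f::finite) \<times> 3) ^ (('a + 'f) \<times> 3) \<Rightarrow> real ^ ('f \<times> 3) ^ ('f \<times> 3)" where
  "block_ff D = (\<chi> u v. D $ (Inr (fst u), snd u) $ (Inr (fst v), snd v))"

definition block_fa ::
    "real ^ (('a::finite + 'f::finite) \<times> 3) ^ (('a + 'f) \<times> 3) \<Rightarrow> real ^ ('a \<times> 3) ^ ('f \<times> 3)" where
  "block_fa D = (\<chi> u v. D $ (Inr (fst u), snd u) $ (Inl (fst v), snd v))"


subsection \<open>Infinitesimal rigidity\<close>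

definition trivial_motions :: "real ^ ('v::finite \<times> 3) \<Rightarrow> (real ^ ('v \<times> 3)) set" where
  "trivial_motions p =
     span (range (\<lambda>c::3. stack (\<lambda>i. axis c 1)) \<union> {p} \<union>
           {stack (\<lambda>i. A *v pos p i) | A :: real ^ 3 ^ 3. A + transpose A = 0})"

definition infinitesimally_rigid ::
    "('a::{finite,linorder}, 'f::{finite,linorder}) graph \<Rightarrow> ('a + 'f) quintuple set \<Rightarrow>
     (('a + 'f) quintuple \<Rightarrow> real ^ 4) \<Rightarrow> ('a, 'f) config \<Rightarrow> bool" where
  "infinitesimally_rigid E X \<mu> p \<longleftrightarrow>
     {\<delta>. rigidity_matrix E X \<mu> p *v \<delta> = 0} = trivial_motions p"


subsection \<open>Localization protocol\<close>

definition localization_protocol ::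
    "('a::{finite,linorder}, 'f::{finite,linorder}) graph \<Rightarrow> ('a + 'f) quintuple set \<Rightarrow>
     (('a + 'f) quintuple \<Rightarrow> real ^ 4) \<Rightarrow> ('a, 'f) config \<Rightarrow> (real \<Rightarrow> real ^ ('f \<times> 3)) \<Rightarrow> bool" where
  "localization_protocol E X \<mu> p phat \<longleftrightarrow>
     (let D = information_matrix E X \<mu> p in
      \<forall>t\<ge>0. (phat has_vector_derivative
               - (block_ff D *v phat t) - block_fa D *v anchor_part p) (at t within {0..}))"

end

theory Submission
  imports Defs
begin

text \<open>
  A rigid network has \<open>p\<close> itself (the scaling motion) in the null space of \<open>R\<close>, so \<open>D p = 0\<close> and the
  estimation error obeys \<open>e' = - D\<^sub>f\<^sub>f e\<close>. A vector annihilated by the quadratic form of \<open>D\<^sub>f\<^sub>f\<close>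
  extends by zero on the anchors to a trivial motion; a trivial motion that fixes three non-colinear
  points is zero, so \<open>D\<^sub>f\<^sub>f\<close> is positive definite and \<open>exp (2 \<kappa> t) \<parallel>e\<parallel>\<^sup>2\<close> is nonincreasing, with
  \<open>\<kappa>\<close> the minimum of the quadratic form on the unit sphere.
\<close>

section \<open>Stacked vectors and their node blocks\<close>

lemma pos_stack [simp]: "pos (stack q) i = q i"
  by (simp add: pos_def stack_def vec_eq_iff)

lemma stack_pos [simp]: "stack (pos x) = x"
  by (simp add: pos_def stack_def vec_eq_iff)

lemma pos_diff: "pos (x - y) i = pos x i - pos y i"
  by (simp add: pos_def vec_eq_iff)

lemma stack_add: "stack q + stack r = stack (\<lambda>i. q i + r i)"
  by (simp add: stack_def vec_eq_iff)

lemma stack_scaleR: "c *\<^sub>R stack q = stack (\<lambda>i. c *\<^sub>R q i)"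
  by (simp add: stack_def vec_eq_iff)

lemma inner_eq_sum_pos: "x \<bullet> y = (\<Sum>i\<in>UNIV. pos x i \<bullet> pos y i)"
  by (simp add: inner_vec_def pos_def sum.cartesian_product flip: UNIV_Times_UNIV)

lemma norm_pos_le: "norm (pos x i) \<le> norm x"
proof -
  have "pos x i \<bullet> pos x i \<le> x \<bullet> x"
    unfolding inner_eq_sum_pos[of x x] by (rule member_le_sum) auto
  then show ?thesis by (simp add: norm_le)
qed

lemma sum_UNIV_Plus:
  fixes g :: "'a::finite + 'b::finite \<Rightarrow> 'c::comm_monoid_add"
  shows "sum g UNIV = (\<Sum>i\<in>UNIV. g (Inl i)) + (\<Sum>i\<in>UNIV. g (Inr i))"
  by (simp add: sum.Plus flip: UNIV_Plus_UNIV)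

lemma sum_UNIV_prod:
  fixes g :: "'a::finite \<times> 'b::finite \<Rightarrow> 'c::comm_monoid_add"
  shows "sum g UNIV = (\<Sum>i\<in>UNIV. \<Sum>c\<in>UNIV. g (i, c))"
  by (simp add: sum.cartesian_product flip: UNIV_Times_UNIV)

section \<open>Anchor/free block decomposition\<close>

lemma inner_split_parts:
  "x \<bullet> y = anchor_part x \<bullet> anchor_part y + free_part x \<bullet> free_part y"
  by (simp add: inner_eq_sum_pos sum_UNIV_Plus anchor_part_def free_part_def)

text \<open>At \<open>p\<close> this yields the equilibrium equation of the protocol; on a vector
  vanishing at the anchors only \<open>block_ff\<close> survives.\<close>

lemma free_part_matrix_vector_mult:
  "free_part (D *v x) = block_ff D *v free_part x + block_fa D *v anchor_part x"
  by (simp add: vec_eq_iff free_part_def anchor_part_def block_ff_def block_fa_def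
      matrix_vector_mult_def stack_def pos_def sum_UNIV_prod sum_UNIV_Plus add.commute)

definition extend_by_zero :: "real ^ ('f::finite \<times> 3) \<Rightarrow> ('a::finite, 'f) config" where
  "extend_by_zero z = stack (case_sum (\<lambda>_. 0) (pos z))"

lemma free_part_extend_by_zero [simp]: "free_part (extend_by_zero z) = z"
  by (simp add: free_part_def extend_by_zero_def)

lemma anchor_part_extend_by_zero [simp]: "anchor_part (extend_by_zero z) = 0"
  by (simp add: anchor_part_def extend_by_zero_def) (simp add: stack_def vec_eq_iff)

text \<open>The free block of a Gram matrix has as quadratic form the full form restricted to
  perturbations that move free nodes only. Definiteness of the block thus becomes injectivity of
  \<open>R\<close> on such perturbations.\<close>

lemma inner_block_ff:
  fixes R :: "real ^ (('a::finite + 'f::finite) \<times> 3) ^ 'r::finite"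
  shows "z \<bullet> (block_ff (transpose R ** R) *v z) = (norm (R *v extend_by_zero z))\<^sup>2"
proof -
  let ?d = "extend_by_zero z :: ('a, 'f) config" and ?D = "transpose R ** R"
  have "z \<bullet> (block_ff ?D *v z) = ?d \<bullet> (?D *v ?d)"
    unfolding inner_split_parts[of ?d] free_part_matrix_vector_mult by simp
  also have "\<dots> = (R *v ?d) \<bullet> (R *v ?d)"
    by (metis dot_lmul_matrix inner_commute matrix_vector_mul_assoc transpose_matrix_vector)
  finally show ?thesis by (simp add: power2_norm_eq_inner)
qed

section \<open>Trivial motions in three dimensions\<close>

lemma skew_eq_cross3:
  fixes A :: "real ^ 3 ^ 3"
  assumes "A + transpose A = 0"
  shows "A *v x = cross3 (vector [A $ 3 $ 2, A $ 1 $ 3, A $ 2 $ 1]) x"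
proof -
  have skew: "A $ i $ j = - A $ j $ i" for i j
    using assms by (simp add: vec_eq_iff transpose_def) (metis add_eq_0_iff)
  have diag: "A $ i $ i = 0" for i
    using skew[of i i] by simp
  show ?thesis
    \<comment> \<open>The axial vector collects \<open>A $ 3 $ 2\<close>, \<open>A $ 1 $ 3\<close>,
      \<open>A $ 2 $ 1\<close>; skewness turns the three mirrored entries into their
      negatives.\<close>
    using skew[of 2 3] skew[of 3 1] skew[of 1 2]
    by (simp add: vec_eq_iff forall_3 matrix_vector_mult_def sum_3 cross3_def diag)
qed

text \<open>Translation, scale and rotation parameters \<open>(v, s, a)\<close> enter the motion
  linearly, so its range is a subspace, and it suffices to find the spanning motions in it.\<close>

lemma trivial_motionE:
  assumes "\<delta> \<in> trivial_motions p"
  obtains v s a where "\<And>i. pos \<delta> i = v + s *\<^sub>R pos p i + cross3 a (pos p i)"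
proof -
  let ?m = "\<lambda>(v, s, a). stack (\<lambda>i. v + s *\<^sub>R pos p i + cross3 a (pos p i))"
  have lin: "linear ?m"
    by (rule linearI)
      (auto simp: stack_add stack_scaleR scaleR_right_distrib scaleR_left_distrib
        cross_add_left cross_mult_left algebra_simps)
  have "trivial_motions p \<subseteq> range ?m"
    unfolding trivial_motions_def
  proof (rule span_minimal)
    show "subspace (range ?m)"
      using lin by (simp add: linear_subspace_image)
    have "stack (\<lambda>i. axis c 1) \<in> range ?m" for c
      by (rule range_eqI[of _ _ "(axis c 1, 0, 0)"]) simp
    moreover have "p \<in> range ?m"
      by (rule range_eqI[of _ _ "(0, 1, 0)"]) simp
    moreover have "stack (\<lambda>i. A *v pos p i) \<in> range ?m" if "A + transpose A = 0" for A :: "real ^ 3 ^ 3"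
      by (rule range_eqI[of _ _ "(0, 0, vector [A $ 3 $ 2, A $ 1 $ 3, A $ 2 $ 1])"])
        (simp add: skew_eq_cross3[OF that])
    ultimately show "range (\<lambda>c::3. stack (\<lambda>i. axis c 1)) \<union> {p} \<union>
        {stack (\<lambda>i. A *v pos p i) | A :: real ^ 3 ^ 3. A + transpose A = 0} \<subseteq> range ?m"
      by blast
  qed
  with assms obtain m where "\<delta> = ?m m" by blast
  moreover obtain v s a where "m = (v, s, a)" by (cases m)
  ultimately have "\<And>i. pos \<delta> i = v + s *\<^sub>R pos p i + cross3 a (pos p i)" by simp
  then show thesis by (rule that)
qed

text \<open>Differences of fixed points eliminate the translation. Scaling acts along a difference
  and rotation orthogonally to it, so both effects vanish separately; a nonzero rotation axis cannot
  be parallel to two independent differences.\<close>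

lemma trivial_motion_fixing_noncollinear_eq_0:
  assumes triv: "\<delta> \<in> trivial_motions p"
    and nc: "\<not> collinear {pos p i, pos p j, pos p k}"
    and fixed: "pos \<delta> i = 0" "pos \<delta> j = 0" "pos \<delta> k = 0"
  shows "\<delta> = 0"
proof -
  obtain v s a where motion: "\<And>i. pos \<delta> i = v + s *\<^sub>R pos p i + cross3 a (pos p i)"
    using trivial_motionE[OF triv] by blast
  define u w where "u = pos p i - pos p j" and "w = pos p k - pos p j"
  have nc': "\<not> collinear {0, u, w}"
    using nc by (simp add: u_def w_def collinear_3)
  then have "u \<noteq> 0" by auto
  have "s *\<^sub>R u + cross3 a u = pos \<delta> i - pos \<delta> j" "s *\<^sub>R w + cross3 a w = pos \<delta> k - pos \<delta> j"
    unfolding motion u_def w_def by (simp_all add: cross3_simps)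
  then have u0: "s *\<^sub>R u + cross3 a u = 0" and w0: "s *\<^sub>R w + cross3 a w = 0"
    using fixed by simp_all
  \<comment> \<open>Pairing with \<open>u\<close> removes the rotational term, which is orthogonal
    to \<open>u\<close>.\<close>
  have "s * (u \<bullet> u) = u \<bullet> (s *\<^sub>R u + cross3 a u)"
    by (simp add: inner_add_right dot_cross_self)
  then have s: "s = 0"
    using u0 \<open>u \<noteq> 0\<close> by simp
  have a: "a = 0"
  proof (rule ccontr)
    assume "a \<noteq> 0"
    \<comment> \<open>With \<open>s = 0\<close> both cross products with \<open>a\<close> vanish, so
      \<open>u\<close> and \<open>w\<close> are multiples of the same axis.\<close>
    then obtain c d where "u = c *\<^sub>R a" "w = d *\<^sub>R a"
      using u0 w0 s by (auto simp: cross_eq_0 collinear_lemma)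
    then have "cross3 u w = 0"
      by (simp add: cross_mult_left cross_mult_right)
    with nc' show False
      by (simp add: cross_eq_0)
  qed
  have "v = 0"
    using motion[of i] fixed s a by simp
  then have "pos \<delta> = (\<lambda>i. 0)"
    using motion s a by auto
  then have "\<delta> = stack (\<lambda>i. 0)"
    by (metis stack_pos)
  then show ?thesis
    by (simp add: stack_def vec_eq_iff)
qed

section \<open>Coercivity and exponential decay\<close>

lemma positive_definite_coercive:
  fixes B :: "real ^ 'n ^ 'n"
  assumes positive: "\<And>z. z \<noteq> 0 \<Longrightarrow> z \<bullet> (B *v z) > 0"
  obtains \<kappa> where "\<kappa> > 0" "\<And>z. z \<bullet> (B *v z) \<ge> \<kappa> * (norm z)\<^sup>2"
proof -
  let ?q = "\<lambda>z. z \<bullet> (B *v z)"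
  have "continuous_on (sphere 0 1) ?q"
    by (intro continuous_intros linear_continuous_on_compose[OF continuous_on_id]) simp
  moreover have "sphere (0 :: real ^ 'n) 1 \<noteq> {}"
    by simp
  ultimately obtain m where m: "m \<in> sphere 0 1" "\<And>z. z \<in> sphere 0 1 \<Longrightarrow> ?q m \<le> ?q z"
    using continuous_attains_inf[OF compact_sphere, of 0 1 ?q] by blast
  \<comment> \<open>The form is homogeneous of degree two, so the minimum on the sphere scales to
    every vector.\<close>
  have "?q m * (norm z)\<^sup>2 \<le> ?q z" for z
  proof (cases "z = 0")
    case False
    have "?q m \<le> ?q (z /\<^sub>R norm z)"
      by (rule m) (simp add: False)
    also have "\<dots> = ?q z / (norm z)\<^sup>2"
      by (simp add: matrix_vector_mult_scaleR power2_eq_square divide_simps)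
    finally show ?thesis
      using False by (simp add: field_simps)
  qed simp
  moreover have "m \<noteq> 0" using m(1) by auto
  ultimately show thesis
    using that positive by blast
qed

lemma coercive_flow_exponential_decay:
  fixes B :: "real ^ 'n ^ 'n" and e :: "real \<Rightarrow> real ^ 'n"
  assumes coercive: "\<And>z. z \<bullet> (B *v z) \<ge> \<kappa> * (norm z)\<^sup>2"
    and flow: "\<And>t. t \<ge> 0 \<Longrightarrow> (e has_vector_derivative - (B *v e t)) (at t within {0..})"
    and "t \<ge> 0"
  shows "norm (e t) \<le> exp (- \<kappa> * t) * norm (e 0)"
proof -
  let ?g = "\<lambda>t. exp (2 * \<kappa> * t) * (e t \<bullet> e t)"
  let ?g' = "\<lambda>t. exp (2 * \<kappa> * t) * (2 * \<kappa> * (e t \<bullet> e t) - 2 * (e t \<bullet> (B *v e t)))"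
  have deriv: "(?g has_real_derivative ?g' x) (at x within {0..t})" if "x \<in> {0..t}" for x
  proof -
    \<comment> \<open>The one-sided derivative on \<open>{0..}\<close> restricts to
      \<open>{0..t}\<close>, which covers the endpoint 0.\<close>
    have e': "(e has_derivative (\<lambda>h. h *\<^sub>R - (B *v e x))) (at x within {0..t})"
      using flow[of x] that
      by (auto simp: has_vector_derivative_def intro: has_derivative_subset)
    have "((\<lambda>t. e t \<bullet> e t) has_real_derivative - 2 * (e x \<bullet> (B *v e x))) (at x within {0..t})"
      unfolding has_field_derivative_def
      by (rule has_derivative_eq_rhs[OF has_derivative_inner[OF e' e']])
        (auto simp: inner_commute algebra_simps)
    then show ?thesis
      by (auto intro!: derivative_eq_intros simp: algebra_simps)
  qed
  have "?g t \<le> ?g 0"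
  proof -
    \<comment> \<open>This form of the mean value theorem allows a degenerate interval, so
      \<open>t = 0\<close> needs no separate case.\<close>
    obtain x where x: "x \<in> {0..t}" "?g t - ?g 0 = ?g' x * (t - 0)"
      using mvt_very_simple[OF \<open>t \<ge> 0\<close>, of ?g "\<lambda>x. (*) (?g' x)"] deriv
      unfolding has_field_derivative_def by (metis (no_types, lifting) atLeastAtMost_iff)
    have "?g' x \<le> 0"
      using coercive[of "e x"] by (simp add: mult_le_0_iff power2_norm_eq_inner)
    then have "?g' x * (t - 0) \<le> 0"
      using \<open>t \<ge> 0\<close> by (metis diff_zero mult_nonpos_nonneg)
    then show ?thesis using x(2) by linarith
  qed
  \<comment> \<open>Removing the weight bounds the squared norm with rate
    \<open>2 * \<kappa>\<close>; the square root halves the rate to \<kappa>.\<close>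
  then have "exp (- (2 * \<kappa> * t)) * ?g t \<le> exp (- (2 * \<kappa> * t)) * ?g 0"
    by (rule mult_left_mono) simp
  moreover have "exp (- (2 * \<kappa> * t)) * ?g t = (norm (e t))\<^sup>2"
    by (simp add: power2_norm_eq_inner exp_minus)
  moreover have "exp (- (2 * \<kappa> * t)) * ?g 0 = (exp (- \<kappa> * t) * norm (e 0))\<^sup>2"
    by (simp add: power2_norm_eq_inner power_mult_distrib mult.assoc flip: exp_double)
  ultimately have "(norm (e t))\<^sup>2 \<le> (exp (- \<kappa> * t) * norm (e 0))\<^sup>2"
    by simp
  then show ?thesis
    by (rule power2_le_imp_le) simp
qed

section \<open>Global exponential convergence of the estimates\<close>

theorem theorem8:
  fixes E :: "('a::{finite,linorder}, 'f::{finite,linorder}) graph"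
    and M :: measurement_type
    and X :: "('a + 'f) quintuple set"
    and \<mu> :: "('a + 'f) quintuple \<Rightarrow> real ^ 4"
    and p :: "('a, 'f) config"
  assumes graph: "undirected_graph E"
    and constraints: "displacement_constraints M E X \<mu> p"
    and not_collocated: "inj (pos p)"
    and anchor_degree: "\<forall>i. card (neighbors E (Inl i) \<inter> range Inl) \<ge> 2"
    and free_degree: "\<forall>i. card (neighbors E (Inr i)) \<ge> 4"
    and free_non_colinear:
      "M \<in> {Relative_Bearing, Angle} \<Longrightarrow>
       \<forall>i. \<not> collinear (pos p ` insert (Inr i) (neighbors E (Inr i)))"
    and anchor_number: "CARD('a) \<ge> 3"
    and anchors_non_colinear:
      "\<exists>i j k :: 'a. \<not> collinear {pos p (Inl i), pos p (Inl j), pos p (Inl k)}"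
    and rigid: "infinitesimally_rigid E X \<mu> p"
  shows "\<exists>C \<kappa>. C > 0 \<and> \<kappa> > 0 \<and>
    (\<forall>phat. localization_protocol E X \<mu> p phat \<longrightarrow>
      (\<forall>i. \<forall>t\<ge>0. norm (pos (phat t) i - pos p (Inr i))
                    \<le> C * exp (- \<kappa> * t) * norm (phat 0 - free_part p)))"
proof -
  let ?R = "rigidity_matrix E X \<mu> p" and ?D = "information_matrix E X \<mu> p"
  let ?B = "block_ff ?D"
  have null_R: "{\<delta>. ?R *v \<delta> = 0} = trivial_motions p"
    using rigid by (simp add: infinitesimally_rigid_def)
  have "p \<in> trivial_motions p"
    unfolding trivial_motions_def by (rule span_base) simp
  then have "?R *v p = 0"
    using null_R by blast
  then have "?D *v p = 0"
    by (simp add: information_matrix_def flip: matrix_vector_mul_assoc)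
  moreover have "free_part (0 :: ('a, 'f) config) = 0"
    by (simp add: free_part_def stack_def pos_def vec_eq_iff)
  ultimately have equilibrium: "?B *v free_part p + block_fa ?D *v anchor_part p = 0"
    by (metis free_part_matrix_vector_mult)
  obtain i j k :: 'a where nc: "\<not> collinear {pos p (Inl i), pos p (Inl j), pos p (Inl k)}"
    using anchors_non_colinear by blast
  have pd: "z \<bullet> (?B *v z) > 0" if "z \<noteq> 0" for z
  proof -
    have "?R *v extend_by_zero z \<noteq> 0"
    proof
      assume "?R *v extend_by_zero z = 0"
      then have "extend_by_zero z \<in> trivial_motions p"
        using null_R by blast
      then have "(extend_by_zero z :: ('a, 'f) config) = 0"
        by (rule trivial_motion_fixing_noncollinear_eq_0[OF _ nc]) (simp_all add: extend_by_zero_def)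
      then have "z = free_part (0 :: ('a, 'f) config)"
        by (metis free_part_extend_by_zero)
      then show False
        using that by (simp add: free_part_def stack_def pos_def vec_eq_iff)
    qed
    then show ?thesis
      by (simp add: information_matrix_def inner_block_ff)
  qed
  obtain \<kappa> where \<kappa>: "\<kappa> > 0" "\<And>z. z \<bullet> (?B *v z) \<ge> \<kappa> * (norm z)\<^sup>2"
    using positive_definite_coercive[OF pd] by blast
  \<comment> \<open>The constant 1 suffices, and \<kappa> comes from \<open>?B\<close> alone. Both
    are therefore shared by all trajectories and initial estimates, which makes the convergence
    global.\<close>
  have "norm (pos (phat t) i - pos p (Inr i)) \<le> 1 * exp (- \<kappa> * t) * norm (phat 0 - free_part p)"
    if protocol: "localization_protocol E X \<mu> p phat" and "t \<ge> 0" for phat i t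
  proof -
    let ?e = "\<lambda>t. phat t - free_part p"
    have "(?e has_vector_derivative - (?B *v ?e t)) (at t within {0..})" if "t \<ge> 0" for t
    proof -
      \<comment> \<open>The equilibrium equation replaces the constant anchor term by
        \<open>?B *v free_part p\<close>, turning the affine protocol into a linear flow for the
        error.\<close>
      have "- (?B *v phat t) - block_fa ?D *v anchor_part p = - (?B *v ?e t)"
        using equilibrium by (simp add: matrix_vector_mult_diff_distrib algebra_simps add_eq_0_iff)
      then show ?thesis
        using protocol that
        by (auto simp: localization_protocol_def Let_def intro!: derivative_eq_intros)
    qed
    then have "norm (?e t) \<le> exp (- \<kappa> * t) * norm (?e 0)"
      using coercive_flow_exponential_decay[OF \<kappa>(2)] \<open>t \<ge> 0\<close> by blast
    \<comment> \<open>The error at one node is a block of the stacked error, so its norm is no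
      larger.\<close>
    moreover have "pos (phat t) i - pos p (Inr i) = pos (?e t) i"
      by (simp add: pos_diff free_part_def)
    ultimately show ?thesis
      using norm_pos_le[of "?e t" i] by simp
  qed
  with \<kappa>(1) show ?thesis
    by (intro exI[of _ 1] exI[of _ \<kappa>]) auto
qed

end
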